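(* Let $f\in\mathcal{P}^{*}$ and let $H_{2,1}(F_{f^{-1}}/2)=\Gamma_1\Gamma_3-\Gamma_2^2$ be the second-order Hankel determinant of the logarithmic inverse coefficients of $f$. Then $$\bigl|H_{2,1}(F_{f^{-1}}/2)\bigr|\le \frac{11}{96}.$$ The inequality is sharp: there is a function in $\mathcal{P}^{*}$ for which equality holds.
   Context: Let $\mathbb{D}=\{z\in\mathbb{C}:|z|<1\}$. $\mathcal{S}$ is the class of functions $f$ that are analytic and univalent (injective) in $\mathbb{D}$ with expansion $f(z)=z+\sum_{n\ge 2}a_n z^n$. A Schwarz function is an analytic $\omega:\mathbb{D}\to\mathbb{C}$ with $\omega(0)=0$ and $|\omega(z)|<1$ for all $z\in\mathbb{D}$. For $g,h$ analytic in $\mathbb{D}$, $g\prec h$ ($g$ is subordinate to $h$) means that there is a Schwarz function $\omega$ with $g(z)=h(\omega(z))$ for all $z\in\mathbb{D}$. The class $\mathcal{P}^{*}$ is $$\mathcal{P}^{*}=\{f\in\mathcal{S}: f'(z)\prec e^{z}(1+\sin z),\ z\in\mathbb{D}\}.$$ For $f\in\mathcal{S}$, the inverse $f^{-1}$ is analytic in $|w|<1/4$, and the logarithmic inverse coefficients $\Gamma_n$ of $f$ are defined by $F_{f^{-1}}(w):=\log\frac{f^{-1}(w)}{w}=2\sum_{n=1}^{\infty}\Gamma_n w^n$, $|w|<1/4$ (branch of the logarithm vanishing at $w=0$). Explicitly, $$\Gamma_1=-\tfrac12a_2,\quad \Gamma_2=-\tfrac12a_3+\tfrac34a_2^2,\quad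 \Gamma_3=-\tfrac12\left(a_4-4a_2a_3+\tfrac{10}{3}a_2^3\right).$$ *)

theory Defs
  imports "HOL-Complex_Analysis.Complex_Analysis"
begin

abbreviation unit_disc :: "complex set" where
  "unit_disc \<equiv> ball 0 1"

(* Functions are total; only their values on the unit disc matter below. *)
definition class_S :: "(complex \<Rightarrow> complex) set" where
  "class_S = {f. f holomorphic_on unit_disc \<and> inj_on f unit_disc \<and> f 0 = 0 \<and> deriv f 0 = 1}"

definition schwarz_function :: "(complex \<Rightarrow> complex) \<Rightarrow> bool" where
  "schwarz_function \<omega> \<longleftrightarrow>
     \<omega> holomorphic_on unit_disc \<and> \<omega> 0 = 0 \<and> (\<forall>z\<in>unit_disc. norm (\<omega> z) < 1)"

definition subordinate :: "(complex \<Rightarrow> complex) \<Rightarrow> (complex \<Rightarrow> complex) \<Rightarrow> bool"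
    (infix "\<prec>\<^sub>s" 50) where
  "g \<prec>\<^sub>s h \<longleftrightarrow>
     g holomorphic_on unit_disc \<and> h holomorphic_on unit_disc \<and>
     (\<exists>\<omega>. schwarz_function \<omega> \<and> (\<forall>z\<in>unit_disc. g z = h (\<omega> z)))"

definition class_P_star :: "(complex \<Rightarrow> complex) set" where
  "class_P_star = {f \<in> class_S. deriv f \<prec>\<^sub>s (\<lambda>z. exp z * (1 + sin z))}"

(* F is the analytic branch of log (f^{-1}(w) / w) on |w| < 1/4 that vanishes at w = 0,
   where the quotient is continued by its limit 1. For f in class_S, the image of the unit
   disc contains this disc by the Koebe one-quarter theorem, so the_inv_into is the genuine
   inverse there, and exactly one such branch exists (up to its values for |w| >= 1/4).
   The principal logarithm Ln would not do: it need not be analytic on all of |w| < 1/4. *)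
definition log_inverse_branch :: "(complex \<Rightarrow> complex) \<Rightarrow> (complex \<Rightarrow> complex) \<Rightarrow> bool" where
  "log_inverse_branch f F \<longleftrightarrow>
     F holomorphic_on ball 0 (1/4) \<and> F 0 = 0 \<and>
     (\<forall>w\<in>ball 0 (1/4) - {0}. exp (F w) = the_inv_into unit_disc f w / w)"

(* The sequence Gamma with F(w) = 2 * (SUM n>=1. Gamma n * w^n) for |w| < 1/4.
   The index 0 does not occur in the series; Gamma 0 is set to 0 for uniqueness. *)
definition log_inverse_coeff :: "(complex \<Rightarrow> complex) \<Rightarrow> nat \<Rightarrow> complex" where
  "log_inverse_coeff f =
     (THE \<Gamma>. \<Gamma> 0 = 0 \<and>
        (\<exists>F. log_inverse_branch f F \<and>
             (\<forall>w\<in>ball 0 (1/4). (\<lambda>n. 2 * \<Gamma> (Suc n) * w ^ Suc n) sums F w)))"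

definition hankel_log_inverse :: "(complex \<Rightarrow> complex) \<Rightarrow> complex" where
  "hankel_log_inverse f =
     log_inverse_coeff f 1 * log_inverse_coeff f 3 - (log_inverse_coeff f 2)\<^sup>2"

end

theory Submission
  imports Defs
begin

text \<open>
  If \<open>f' = exp \<omega> (1 + sin \<omega>)\<close> with a Schwarz function \<open>\<omega> = c\<^sub>1 z + c\<^sub>2 z\<^sup>2 + c\<^sub>3 z\<^sup>3 + \<dots>\<close>, then the first
  coefficients of \<open>f\<close>, and with them the Hankel determinant, are polynomials in \<open>c\<^sub>1, c\<^sub>2, c\<^sub>3\<close>
  (\<open>log_inverse_coeffs_low\<close>, \<open>hankel_log_inverse_eq_schwarz_coeffs\<close>):
  \<open>288 H = 33 c\<^sub>1\<^sup>4 + 36 c\<^sub>1 c\<^sub>3 - 42 c\<^sub>1\<^sup>2 c\<^sub>2 - 32 c\<^sub>2\<^sup>2\<close>.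
  Two steps of the Schur algorithm describe all possible triples: with \<open>s = \<bar>c\<^sub>1\<bar>\<^sup>2\<close> and \<open>q = 1 - s\<close> one has
  \<open>c\<^sub>2 = q x\<close> and \<open>c\<^sub>3 = q (y - cnj c\<^sub>1 x\<^sup>2)\<close>, where \<open>\<bar>x\<bar> \<le> 1\<close> and \<open>\<bar>y\<bar> \<le> 1 - \<bar>x\<bar>\<^sup>2\<close>
  (\<open>schwarz_function_schur_parameters\<close>). After a rotation of \<open>x\<close> this gives
  \<open>288 \<bar>H\<bar> \<le> \<bar>A - B x - C x\<^sup>2\<bar> + 36 \<bar>c\<^sub>1\<bar> q (1 - \<bar>x\<bar>\<^sup>2)\<close>
  with \<open>A = 33 s\<^sup>2\<close>, \<open>B = 42 s q\<close> and \<open>C = (32 + 4 s) q\<close>. The problem reduces to \<open>\<bar>x\<bar> = 1\<close>, where the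
  modulus of the trinomial is at most \<open>33\<close> by a computation with one real variable \<open>Re x\<close> and the parameter
  \<open>s\<close> (\<open>norm_hankel_in_schur_parameters_le\<close>). Since \<open>33 / 288 = 11 / 96\<close>, this is the claimed bound.

  The coefficients are defined through a branch of \<open>log (g w / w)\<close> on \<open>\<bar>w\<bar> < 1/4\<close>, where \<open>g\<close> is the inverse
  of \<open>f\<close>; for it to exist, the image of \<open>f\<close> must contain that disc. For this class it does for an
  elementary reason: \<open>Re (exp z (1 + sin z)) \<ge> 1 - 2 \<bar>z\<bar>\<close> for \<open>\<bar>z\<bar> \<le> 1/2\<close>, and integration along radii
  shows \<open>\<bar>f z\<bar> \<ge> 1/4\<close> for \<open>\<bar>z\<bar> = 1/2\<close> (\<open>class_P_star_covers_quarter_disc\<close>).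

  Equality holds for \<open>\<omega> z = z\<close>. The issue is whether the resulting function is univalent, since its
  derivative \<open>exp z (1 + sin z)\<close> does not have positive real part. It is close-to-convex: relative to
  \<open>exp\<close>, which maps the disc onto a convex set (\<open>norm_Ln_exp_segment_less_1\<close>), its derivative is
  \<open>1 + sin z\<close>, and this has positive real part (\<open>Re_one_plus_sin_pos\<close>, \<open>inj_on_extremal\<close>).
\<close>

section \<open>Schur parameters of Schwarz functions\<close>

lemma schwarz_functionD:
  assumes "schwarz_function \<omega>"
  shows "\<omega> holomorphic_on ball 0 1" "\<omega> 0 = 0" "\<And>z. norm z < 1 \<Longrightarrow> norm (\<omega> z) < 1"
  using assms by (auto simp: schwarz_function_def)

lemma schwarz_function_has_fps_expansion:
  assumes "schwarz_function \<omega>"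
  shows "\<omega> has_fps_expansion fps_expansion \<omega> 0"
  by (rule has_fps_expansion_fps_expansion[of "ball 0 1"]) (use schwarz_functionD[OF assms] in auto)

lemma schwarz_function_coeffs:
  assumes \<omega>: "schwarz_function \<omega>" and W: "\<omega> has_fps_expansion W"
  shows "fps_nth W 0 = 0" "fps_nth W 1 = deriv \<omega> 0" "norm (fps_nth W 1) \<le> 1"
proof -
  show "fps_nth W 0 = 0"
    using fps_nth_fps_expansion[OF W, of 0] schwarz_functionD[OF \<omega>] by simp
  show 1: "fps_nth W 1 = deriv \<omega> 0"
    using fps_nth_fps_expansion[OF W, of 1] by simp
  show "norm (fps_nth W 1) \<le> 1"
    unfolding 1 using Schwarz_Lemma(2)[OF schwarz_functionD[OF \<omega>], of 0] by simp
qed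

text \<open>
  Dividing by \<open>z\<close> turns a Schwarz function into a self-map of the closed disc, and a Moebius
  transformation brings its value at the origin back to \<open>0\<close>. The result is again a Schwarz function,
  one coefficient shorter; only rotations escape, because their quotient is a unimodular constant. The
  relation is stated without denominators so that coefficients can be compared directly.
\<close>
lemma schur_step:
  assumes \<omega>: "schwarz_function \<omega>"
  defines "c \<equiv> deriv \<omega> 0"
  shows "(norm c = 1 \<and> (\<forall>z\<in>ball 0 1. \<omega> z = c * z)) \<or>
         (\<exists>\<psi>. schwarz_function \<psi> \<and>
              (\<forall>z\<in>ball 0 1. \<omega> z * (1 + cnj c * \<psi> z) = z * (\<psi> z + c)))"
proof (cases "norm c = 1")
  case True
  then obtain a where a: "\<And>z. norm z < 1 \<Longrightarrow> \<omega> z = a * z"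
    using Schwarz_Lemma(3)[OF schwarz_functionD[OF \<omega>], of 0] by (auto simp: c_def)
  have "(\<omega> has_field_derivative a) (at 0)"
    by (rule has_field_derivative_transform_within_open[of "\<lambda>z. a * z" _ _ "ball 0 1"])
       (auto intro!: derivative_eq_intros simp: a)
  hence "c = a" unfolding c_def by (rule DERIV_imp_deriv)
  thus ?thesis using True a by auto
next
  case False
  note S = schwarz_functionD[OF \<omega>]
  have c1: "norm c < 1"
    using False Schwarz_Lemma(2)[OF S, of 0] by (simp add: c_def)
  obtain h where h: "h holomorphic_on ball 0 1" "\<And>z. norm z < 1 \<Longrightarrow> \<omega> z = z * h z" "deriv \<omega> 0 = h 0"
    using Schwarz3[OF S(1,2)] by blast
  have hlt: "norm (h z) < 1" if z: "norm z < 1" for z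
  proof (cases "z = 0")
    case True
    thus ?thesis using c1 h(3) by (simp add: c_def)
  next
    case z0: False
    have "norm (\<omega> z) \<noteq> norm z"
    proof
      assume "norm (\<omega> z) = norm z"
      then obtain a where a: "\<And>z. norm z < 1 \<Longrightarrow> \<omega> z = a * z" "norm a = 1"
        using Schwarz_Lemma(3)[OF S, of 0] z z0 by auto
      have "(\<omega> has_field_derivative a) (at 0)"
        by (rule has_field_derivative_transform_within_open[of "\<lambda>z. a * z" _ _ "ball 0 1"])
           (auto intro!: derivative_eq_intros simp: a)
      hence "c = a" unfolding c_def by (rule DERIV_imp_deriv)
      thus False using a False by simp
    qed
    hence "norm (\<omega> z) < norm z"
      using Schwarz_Lemma(1)[OF S z] by simp
    thus ?thesis using z0 h(2)[OF z] by (simp add: norm_mult)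
  qed
  define \<psi> where "\<psi> = Moebius_function 0 c \<circ> h"
  have "\<psi> holomorphic_on ball 0 1"
    unfolding \<psi>_def
    by (rule holomorphic_on_compose_gen[OF h(1) Moebius_function_holomorphic[OF c1]])
       (auto simp: hlt)
  moreover have "\<psi> 0 = 0"
    using h(3) by (simp add: \<psi>_def c_def Moebius_function_eq_zero)
  moreover have "norm (\<psi> z) < 1" if "norm z < 1" for z
    using Moebius_function_norm_lt_1[OF c1 hlt[OF that]] by (simp add: \<psi>_def)
  ultimately have "schwarz_function \<psi>"
    by (simp add: schwarz_function_def)
  moreover have "\<omega> z * (1 + cnj c * \<psi> z) = z * (\<psi> z + c)" if z: "z \<in> ball 0 1" for z
  proof -
    have "norm (cnj c * h z) < 1"
      using norm_mult_less[of "cnj c" 1 "h z" 1] c1 hlt[of z] z by simp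
    hence "1 - cnj c * h z \<noteq> 0" by auto
    hence "h z * (1 + cnj c * \<psi> z) = \<psi> z + c"
      by (simp add: \<psi>_def Moebius_function_simple divide_simps) (simp add: algebra_simps)
    hence "z * (h z * (1 + cnj c * \<psi> z)) = z * (\<psi> z + c)" by simp
    thus ?thesis using h(2)[of z] z by (simp add: mult.assoc)
  qed
  ultimately show ?thesis by blast
qed

text \<open>
  Comparing the coefficients of \<open>z\<^sup>2\<close> and \<open>z\<^sup>3\<close> in
  \<open>\<omega> z * (1 + cnj c * \<psi> z) = z * (\<psi> z + c)\<close> expresses them through the first two of \<open>\<psi>\<close>.
\<close>
lemma schur_step_fps:
  assumes \<omega>: "schwarz_function \<omega>" and W: "\<omega> has_fps_expansion W"
  defines "c \<equiv> fps_nth W 1"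
  shows "(norm c = 1 \<and> W = fps_const c * fps_X) \<or>
         (\<exists>\<psi> X. schwarz_function \<psi> \<and> \<psi> has_fps_expansion X \<and>
                fps_nth W 2 = (1 - c * cnj c) * fps_nth X 1 \<and>
                fps_nth W 3 = (1 - c * cnj c) * (fps_nth X 2 - cnj c * (fps_nth X 1)\<^sup>2))"
proof -
  have c: "c = deriv \<omega> 0"
    using schwarz_function_coeffs[OF \<omega> W] by (simp add: c_def)
  have ev: "eventually (\<lambda>z::complex. z \<in> ball 0 1) (nhds 0)"
    by (intro eventually_nhds_in_open) auto
  from schur_step[OF \<omega>] consider
      (rot) "norm c = 1" "\<forall>z\<in>ball 0 1. \<omega> z = c * z"
    | (step) \<psi> where "schwarz_function \<psi>"
        "\<forall>z\<in>ball 0 1. \<omega> z * (1 + cnj c * \<psi> z) = z * (\<psi> z + c)"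
    unfolding c by blast
  thus ?thesis
  proof cases
    case rot
    have "(\<lambda>z. c * z) has_fps_expansion fps_const c * fps_X"
      by (intro fps_expansion_intros)
    also have "?this \<longleftrightarrow> \<omega> has_fps_expansion fps_const c * fps_X"
      by (intro has_fps_expansion_cong refl eventually_mono[OF ev]) (use rot in auto)
    finally have "W = fps_const c * fps_X"
      by (rule fps_expansion_unique_complex[OF W])
    thus ?thesis using rot by simp
  next
    case step
    define X where "X = fps_expansion \<psi> 0"
    have X: "\<psi> has_fps_expansion X"
      unfolding X_def by (rule schwarz_function_has_fps_expansion) fact
    have "(\<lambda>z. \<omega> z * (1 + cnj c * \<psi> z)) has_fps_expansion W * (1 + fps_const (cnj c) * X)"
      by (intro fps_expansion_intros W X)
    also have "?this \<longleftrightarrow> (\<lambda>z. z * (\<psi> z + c)) has_fps_expansion W * (1 + fps_const (cnj c) * X)"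
      by (intro has_fps_expansion_cong refl eventually_mono[OF ev]) (use step in auto)
    finally have 1: "(\<lambda>z. z * (\<psi> z + c)) has_fps_expansion W * (1 + fps_const (cnj c) * X)" .
    have "(\<lambda>z. z * (\<psi> z + c)) has_fps_expansion fps_X * (X + fps_const c)"
      by (intro fps_expansion_intros X)
    with 1 have eq: "W * (1 + fps_const (cnj c) * X) = fps_X * (X + fps_const c)"
      by (rule fps_expansion_unique_complex)
    have W0: "fps_nth W 0 = 0" and X0: "fps_nth X 0 = 0"
      using schwarz_function_coeffs(1)[OF \<omega> W] schwarz_function_coeffs(1)[OF step(1) X] by auto
    have W1: "fps_nth W (Suc 0) = c" by (simp add: c_def)
    have "fps_nth (W * (1 + fps_const (cnj c) * X)) 2 = fps_nth (fps_X * (X + fps_const c)) 2"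
      by (simp only: eq)
    hence 2: "fps_nth W 2 = (1 - c * cnj c) * fps_nth X 1"
      by (simp add: fps_mult_nth[of W] numeral_2_eq_2 W0 W1 X0 algebra_simps)
    have "fps_nth (W * (1 + fps_const (cnj c) * X)) 3 = fps_nth (fps_X * (X + fps_const c)) 3"
      by (simp only: eq)
    hence "fps_nth W 3 + cnj c * (fps_nth W 2 * fps_nth X 1 + c * fps_nth X 2) = fps_nth X 2"
      by (simp add: fps_mult_nth[of W] numeral_3_eq_3 numeral_2_eq_2 W0 W1 X0 algebra_simps)
    hence "fps_nth W 3 = (1 - c * cnj c) * (fps_nth X 2 - cnj c * (fps_nth X 1)\<^sup>2)"
      unfolding 2 by (simp add: algebra_simps power2_eq_square add_eq_0_iff eq_diff_eq)
    thus ?thesis using step(1) X 2 by blast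
  qed
qed

lemma schwarz_function_second_coeff:
  assumes \<omega>: "schwarz_function \<omega>" and W: "\<omega> has_fps_expansion W"
  shows "norm (fps_nth W 2) \<le> 1 - (norm (fps_nth W 1))\<^sup>2"
  using schur_step_fps[OF \<omega> W]
proof (elim disjE exE conjE)
  define c where "c = fps_nth W 1"
  assume "norm (fps_nth W 1) = 1" "W = fps_const (fps_nth W 1) * fps_X"
  hence "norm c = 1" "W = fps_const c * fps_X" by (simp_all add: c_def)
  thus ?thesis by simp
next
  fix \<psi> X assume \<psi>: "schwarz_function \<psi>" "\<psi> has_fps_expansion X"
    and 2: "fps_nth W 2 = (1 - fps_nth W 1 * cnj (fps_nth W 1)) * fps_nth X 1"
  have "1 - fps_nth W 1 * cnj (fps_nth W 1) = complex_of_real (1 - (norm (fps_nth W 1))\<^sup>2)"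
    unfolding of_real_diff of_real_1 complex_norm_square ..
  moreover have "0 \<le> 1 - (norm (fps_nth W 1))\<^sup>2"
    using schwarz_function_coeffs(3)[OF \<omega> W] by (simp add: power_le_one)
  ultimately show ?thesis
    using schwarz_function_coeffs(3)[OF \<psi>] unfolding 2 norm_mult
    by (simp add: mult_left_le del: of_real_diff)
qed

text \<open>
  The parameters \<open>x\<close> and \<open>y\<close> are the first two coefficients of the transformed function \<open>\<psi>\<close>, to which
  the bound on the second coefficient of a Schwarz function applies. For a rotation the factor \<open>1 - c * cnj c\<close> vanishes, and zero parameters serve.
\<close>
lemma schwarz_function_schur_parameters:
  assumes \<omega>: "schwarz_function \<omega>" and W: "\<omega> has_fps_expansion W"
  defines "c \<equiv> fps_nth W 1"
  obtains x y where "norm c \<le> 1" "norm x \<le> 1" "norm y \<le> 1 - (norm x)\<^sup>2"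
    "fps_nth W 2 = (1 - c * cnj c) * x" "fps_nth W 3 = (1 - c * cnj c) * (y - cnj c * x\<^sup>2)"
proof -
  have c: "norm c \<le> 1"
    unfolding c_def by (rule schwarz_function_coeffs(3)[OF \<omega> W])
  from schur_step_fps[OF \<omega> W] show ?thesis
  proof (elim disjE exE conjE)
    assume "norm (fps_nth W 1) = 1" "W = fps_const (fps_nth W 1) * fps_X"
    hence *: "norm c = 1" "W = fps_const c * fps_X" by (simp_all add: c_def)
    have "c * cnj c = 1" using * by (simp add: complex_norm_square[symmetric])
    thus ?thesis using c *(2) by (intro that[of 0 0]) (simp_all add: numeral_3_eq_3)
  next
    fix \<psi> X assume \<psi>: "schwarz_function \<psi>" "\<psi> has_fps_expansion X"
      and "fps_nth W 2 = (1 - fps_nth W 1 * cnj (fps_nth W 1)) * fps_nth X 1"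
      "fps_nth W 3 = (1 - fps_nth W 1 * cnj (fps_nth W 1)) *
         (fps_nth X 2 - cnj (fps_nth W 1) * (fps_nth X 1)\<^sup>2)"
    thus ?thesis
      using that[OF c schwarz_function_coeffs(3)[OF \<psi>] schwarz_function_second_coeff[OF \<psi>]]
      by (simp add: c_def)
  qed
qed

section \<open>An extremal problem for the Schur parameters\<close>

text \<open>
  The left side is the square of \<open>\<bar>A - B e - C e\<^sup>2\<bar>\<close> for \<open>\<bar>e\<bar> = 1\<close> and \<open>Re e = u\<close>, a concave quadratic in
  \<open>u\<close>. For larger \<open>s\<close> its unconstrained maximum \<open>(A + C)\<^sup>2 (1 + B\<^sup>2 / (4 A C))\<close> is small enough. As
  \<open>s\<close> tends to \<open>0\<close>, that maximum is attained outside \<open>[-1, 1]\<close> and becomes too large, so for small \<open>s\<close>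
  the term \<open>-u\<^sup>2\<close> is replaced by its tangent at \<open>1/2\<close>; the resulting linear function is increasing and
  is evaluated at \<open>u = 1\<close>.
\<close>
lemma trinomial_on_circle_real:
  fixes s u :: real
  assumes s: "0 \<le> s" "s \<le> 1" and u: "-1 \<le> u" "u \<le> 1"
  defines "A \<equiv> 33 * s\<^sup>2" and "B \<equiv> 42 * s * (1 - s)" and "C \<equiv> (32 + 4 * s) * (1 - s)"
  shows "(A + C)\<^sup>2 + B\<^sup>2 + 2 * B * (C - A) * u - 4 * A * C * u\<^sup>2 \<le> 33\<^sup>2"
proof (cases "s \<le> 4 / 25")
  case True
  have AC: "0 \<le> A * C"
    using s by (simp add: A_def C_def)
  have "A * C * (u - 1/2)\<^sup>2 \<ge> 0"
    using AC by simp
  hence 1: "- (A * C * u\<^sup>2) \<le> A * C * (1/4 - u)"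
    by (simp add: power2_eq_square algebra_simps)
  have "s * (6576 + 3636 * s) \<le> (4/25) * (6576 + 3636 * 1)"
    using s True by (intro mult_mono add_mono) auto
  hence "0 \<le> 2688 - 6576 * s - 3636 * s\<^sup>2"
    by (simp add: power2_eq_square algebra_simps)
  hence "0 \<le> s * (1 - s) * (2688 - 6576 * s - 3636 * s\<^sup>2)"
    using s by simp
  also have "\<dots> = 2 * B * (C - A) - 4 * A * C"
    by (simp add: A_def B_def C_def power2_eq_square algebra_simps)
  finally have "(2 * B * (C - A) - 4 * A * C) * u \<le> (2 * B * (C - A) - 4 * A * C) * 1"
    using u by (intro mult_left_mono) auto
  with 1 have "(A + C)\<^sup>2 + B\<^sup>2 + 2 * B * (C - A) * u - 4 * A * C * u\<^sup>2 \<le> (C + B - A)\<^sup>2 + A * C"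
    by (simp add: power2_eq_square algebra_simps)
  \<comment> \<open>The terms of degree at most two, \<open>65 - 896 s + 3804 s\<^sup>2\<close>, have no real root: complete the square.\<close>
  also have "\<dots> = 33\<^sup>2 - (3804 * (s - 112/951)\<^sup>2 + 11639/951 + s ^ 3 * (3136 - 6109 * s))"
    by (simp add: A_def B_def C_def power2_eq_square power3_eq_cube algebra_simps)
  also have "\<dots> \<le> 33\<^sup>2"
  proof -
    have "0 \<le> 3804 * (s - 112/951)\<^sup>2" by simp
    moreover have "0 \<le> s ^ 3 * (3136 - 6109 * s)"
      using s True by (intro mult_nonneg_nonneg) auto
    ultimately show ?thesis by linarith
  qed
  finally show ?thesis .
next
  case False
  show ?thesis
  proof (cases "s = 1")
    case True
    thus ?thesis by (simp add: A_def B_def C_def)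
  next
    case s1: False
    define q where "q = 1 - s"
    have q: "0 < q" "q \<le> 21/25" and sq: "s = 1 - q"
      using s s1 False by (auto simp: q_def)
    have AC: "0 < A * C"
      using s s1 False by (auto simp: A_def C_def)
    let ?S = "(A + C)\<^sup>2 + B\<^sup>2 + 2 * B * (C - A) * u - 4 * A * C * u\<^sup>2"
    have "0 \<le> (4 * A * C * u - B * (C - A))\<^sup>2" by simp
    hence 1: "4 * A * C * ?S \<le> (A + C)\<^sup>2 * (4 * A * C + B\<^sup>2)"
      by (simp add: power2_eq_square algebra_simps)
    \<comment> \<open>The two sides of \<open>(A + C)\<^sup>2 (4 A C + B\<^sup>2) \<le> 4 A C 33\<^sup>2\<close>, divided by \<open>12 s\<^sup>2 q\<close>, agree at \<open>s = 1\<close>,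
        so that another \<open>q\<close> factors out of their difference. On \<open>[0, 21/25]\<close> the
        remaining quartic lies above the quadratic obtained from it by \<open>q \<le> 21/25\<close> in the two
        highest terms, and that quadratic is decreasing with a positive value at the right end.\<close>
    have "q\<^sup>2 * (153816 * q + 86623 * q\<^sup>2) \<le> q\<^sup>2 * (153816 * (21/25) + 86623 * (21/25)\<^sup>2)"
      using q by (intro mult_left_mono add_mono power_mono) auto
    moreover have "0 \<le> (21/25 - q) * (910404 - 208000 * (21/25 + q))"
      using q by (intro mult_nonneg_nonneg) auto
    ultimately have R: "0 \<le> 623997 - 910404 * q + 399198 * q\<^sup>2 - 153816 * q ^ 3 - 86623 * q ^ 4"
      using q by (simp add: power2_eq_square power3_eq_cube power4_eq_xxxx algebra_simps)
    have "0 \<le> 12 * s\<^sup>2 * q * (q * (623997 - 910404 * q + 399198 * q\<^sup>2 - 153816 * q ^ 3 - 86623 * q ^ 4))"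
      using R q by (intro mult_nonneg_nonneg) auto
    also have "\<dots> = 4 * A * C * 33\<^sup>2 - (A + C)\<^sup>2 * (4 * A * C + B\<^sup>2)"
      unfolding A_def B_def C_def sq by algebra
    finally have "4 * A * C * ?S \<le> 4 * A * C * 33\<^sup>2"
      using 1 by linarith
    hence "(A * C) * ?S \<le> (A * C) * 33\<^sup>2"
      by linarith
    thus ?thesis
      using AC by (simp only: mult_le_cancel_left_pos)
  qed
qed

lemma norm_trinomial_on_circle:
  fixes e :: complex and A B C :: real
  assumes "norm e = 1"
  shows "(norm (A - B * e - C * e\<^sup>2))\<^sup>2 =
           (A + C)\<^sup>2 + B\<^sup>2 + 2 * B * (C - A) * Re e - 4 * A * C * (Re e)\<^sup>2"
proof -
  have v: "(Im e)\<^sup>2 = 1 - (Re e)\<^sup>2"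
    using cmod_power2[of e] assms by simp
  have "(norm (A - B * e - C * e\<^sup>2))\<^sup>2 =
     (A - B * Re e - C * ((Re e)\<^sup>2 - (Im e)\<^sup>2))\<^sup>2 + (Im e)\<^sup>2 * (B + 2 * C * Re e)\<^sup>2"
    unfolding cmod_power2 by (simp add: power2_eq_square algebra_simps)
  also have "\<dots> = (A + C)\<^sup>2 + B\<^sup>2 + 2 * B * (C - A) * Re e - 4 * A * C * (Re e)\<^sup>2"
    unfolding v by algebra
  finally show ?thesis .
qed

text \<open>
  Writing the trinomial at \<open>t e\<close> as \<open>(1 - t\<^sup>2) A + t\<^sup>2 (A - B e - C e\<^sup>2) - (t - t\<^sup>2) B e\<close> reduces the bound
  inside the disc to the one on the circle, with weights \<open>t\<^sup>2\<close> and \<open>1 - t\<^sup>2\<close>; here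
  \<open>t - t\<^sup>2 \<le> (1 - t\<^sup>2) / 2\<close>.
\<close>
lemma norm_trinomial_le:
  fixes e :: complex and s t :: real
  assumes s: "0 \<le> s" "s \<le> 1" and t: "0 \<le> t" "t \<le> 1" and e: "norm e = 1"
  shows "norm (of_real (33 * s\<^sup>2) - of_real (42 * s * (1 - s)) * (of_real t * e)
                - of_real ((32 + 4 * s) * (1 - s)) * (of_real t * e)\<^sup>2)
         \<le> 33 * t\<^sup>2 + (1 - t\<^sup>2) * (33 * s\<^sup>2 + 21 * s * (1 - s))"
proof -
  define A B C where "A = 33 * s\<^sup>2" and "B = 42 * s * (1 - s)" and "C = (32 + 4 * s) * (1 - s)"
  have AB: "0 \<le> A" "0 \<le> B" using s by (auto simp: A_def B_def)
  have u: "-1 \<le> Re e" "Re e \<le> 1"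
    using abs_Re_le_cmod[of e] e by auto
  have "(norm (A - B * e - C * e\<^sup>2))\<^sup>2 \<le> 33\<^sup>2"
    unfolding norm_trinomial_on_circle[OF e] A_def B_def C_def
    using trinomial_on_circle_real[OF s u] by simp
  hence M: "norm (A - B * e - C * e\<^sup>2) \<le> 33"
    by (rule power2_le_imp_le) simp
  have tt: "0 \<le> 1 - t\<^sup>2" "0 \<le> t - t\<^sup>2"
    using t by (auto simp: power2_eq_square mult_le_one intro: mult_left_le)
  have "A - B * (of_real t * e) - C * (of_real t * e)\<^sup>2 =
        complex_of_real (1 - t\<^sup>2) * complex_of_real A + of_real (t\<^sup>2) * (A - B * e - C * e\<^sup>2) - of_real ((t - t\<^sup>2) * B) * e"
    by (simp add: power2_eq_square algebra_simps)
  also have "norm \<dots> \<le> norm (of_real (1 - t\<^sup>2) * complex_of_real A)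
      + norm (of_real (t\<^sup>2) * (A - B * e - C * e\<^sup>2)) + norm (of_real ((t - t\<^sup>2) * B) * e)"
    by (intro norm_triangle_le_diff norm_triangle_le add_right_mono norm_triangle_ineq)
  also have "\<dots> \<le> (1 - t\<^sup>2) * A + t\<^sup>2 * 33 + (t - t\<^sup>2) * B"
    using M AB tt e unfolding norm_mult norm_of_real
    by (intro add_mono) (auto intro: mult_left_mono)
  also have "(t - t\<^sup>2) * B \<le> ((1 - t\<^sup>2) / 2) * B"
  proof (intro mult_right_mono)
    have "0 \<le> (1 - t)\<^sup>2" by simp
    thus "t - t\<^sup>2 \<le> (1 - t\<^sup>2) / 2" by (simp add: power2_eq_square algebra_simps)
  qed (use AB in auto)
  also have "(1 - t\<^sup>2) * A + t\<^sup>2 * 33 + (1 - t\<^sup>2) / 2 * B =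
             33 * t\<^sup>2 + (1 - t\<^sup>2) * (33 * s\<^sup>2 + 21 * s * (1 - s))"
    by (simp add: A_def B_def field_simps)
  finally show ?thesis
    by (simp only: A_def B_def C_def)
qed

text \<open>
  The Hankel determinant of the logarithmic inverse coefficients of \<open>f\<close>, written in the first three
  Taylor coefficients of a Schwarz function \<open>\<omega>\<close> with \<open>f' = exp \<omega> (1 + sin \<omega>)\<close>.
\<close>
definition hankel_in_schwarz_coeffs :: "complex \<Rightarrow> complex \<Rightarrow> complex \<Rightarrow> complex" where
  "hankel_in_schwarz_coeffs c1 c2 c3 =
     c1 * c3 / 8 - 7 / 48 * c1\<^sup>2 * c2 + 11 / 96 * c1 ^ 4 - c2\<^sup>2 / 9"

text \<open>
  In Schur parameters, \<open>288\<close> times the determinant is \<open>T + 36 q c y\<close>, where \<open>T\<close> is a quadratic in \<open>x\<close>.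
  A rotation of \<open>x\<close> by the argument of \<open>c\<^sup>2\<close> makes the coefficients of \<open>T\<close> real. The triangle inequality
  is affordable only for the term with \<open>y\<close>; bounding the terms of \<open>T\<close> separately would exceed \<open>33\<close>
  when \<open>\<bar>c\<bar>\<close> is close to \<open>1\<close>.
\<close>
lemma norm_hankel_in_schur_parameters_le:
  fixes c x y :: complex
  assumes c: "norm c \<le> 1" and x: "norm x \<le> 1" and y: "norm y \<le> 1 - (norm x)\<^sup>2"
  defines "q \<equiv> 1 - c * cnj c"
  shows "norm (hankel_in_schwarz_coeffs c (q * x) (q * (y - cnj c * x\<^sup>2))) \<le> 11 / 96"
proof -
  define s where "s = (norm c)\<^sup>2"
  define t where "t = norm x"
  have s: "0 \<le> s" "s \<le> 1" using c by (auto simp: s_def power_le_one)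
  have t: "0 \<le> t" "t \<le> 1" using x by (auto simp: t_def)
  have tt: "0 \<le> 1 - t\<^sup>2" using t by (simp add: power_le_one)
  have cc: "c * cnj c = of_real s"
    by (simp add: s_def complex_norm_square[symmetric])
  hence q: "q = of_real (1 - s)" by (simp add: q_def)
  define T where "T = 33 * c ^ 4 - 42 * q * c\<^sup>2 * x - (32 + 4 * of_real s) * q * x\<^sup>2"
  have "288 * hankel_in_schwarz_coeffs c (q * x) (q * (y - cnj c * x\<^sup>2)) =
        33 * c ^ 4 + 36 * q * c * y - 42 * q * c\<^sup>2 * x - 36 * (c * cnj c) * q * x\<^sup>2 - 32 * q\<^sup>2 * x\<^sup>2"
    unfolding hankel_in_schwarz_coeffs_def by (simp add: field_simps power2_eq_square)
  also have "\<dots> = T + 36 * q * c * y"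
    unfolding T_def cc q by (simp add: field_simps power2_eq_square)
  finally have eq: "288 * hankel_in_schwarz_coeffs c (q * x) (q * (y - cnj c * x\<^sup>2)) = T + 36 * q * c * y" .
  have T: "norm T \<le> 33 * t\<^sup>2 + (1 - t\<^sup>2) * (33 * s\<^sup>2 + 21 * s * (1 - s))"
  proof (cases "c = 0 \<or> x = 0")
    case True
    show ?thesis
    proof (cases "c = 0")
      case True
      thus ?thesis by (simp add: T_def q s_def t_def norm_mult norm_power)
    next
      case False
      hence "x = 0" using True by simp
      moreover have "norm c ^ 4 = s\<^sup>2" by (simp add: s_def power_mult[symmetric])
      ultimately show ?thesis using s
        by (simp add: T_def t_def norm_mult norm_power)
    qed
  next
    case False
    hence s0: "s \<noteq> 0" and t0: "t \<noteq> 0" by (auto simp: s_def t_def)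
    define r where "r = c\<^sup>2 / of_real s"
    define e where "e = x / (of_real t * r)"
    have r: "norm r = 1" using s0 by (simp add: r_def norm_divide norm_power s_def)
    hence r0: "r \<noteq> 0" by auto
    have e: "norm e = 1" using r t0 by (simp add: e_def norm_divide norm_mult t_def)
    have xe: "x = of_real t * e * r" using r0 t0 by (simp add: e_def)
    have cr: "c\<^sup>2 = of_real s * r" using s0 by (simp add: r_def)
    have c4: "c ^ 4 = (c\<^sup>2)\<^sup>2" by simp
    have "T = r\<^sup>2 * (of_real (33 * s\<^sup>2) - of_real (42 * s * (1 - s)) * (of_real t * e)
                - of_real ((32 + 4 * s) * (1 - s)) * (of_real t * e)\<^sup>2)"
      unfolding T_def c4 cr q xe by (simp add: power2_eq_square algebra_simps)
    thus ?thesis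
      using norm_trinomial_le[OF s t e] r by (simp add: norm_mult norm_power)
  qed
  have "norm (36 * q * c * y) \<le> 36 * (1 - s) * norm c * (1 - t\<^sup>2)"
    using s y unfolding norm_mult q norm_of_real
    by (intro mult_mono) (auto simp: t_def)
  with T have "norm (T + 36 * q * c * y) \<le>
      33 * t\<^sup>2 + (1 - t\<^sup>2) * (33 * s\<^sup>2 + 21 * s * (1 - s) + 36 * (1 - s) * norm c)"
    by (intro norm_triangle_le) (simp add: algebra_simps)
  \<comment> \<open>The weight of \<open>1 - t\<^sup>2\<close> is also at most \<open>33\<close>, because \<open>36 c \<le> 33 + 12 c\<^sup>2\<close> for real \<open>c\<close>.\<close>
  also have "33 * s\<^sup>2 + 21 * s * (1 - s) + 36 * (1 - s) * norm c
      = 33 - (1 - s) * (12 * (norm c - 3/2)\<^sup>2 + 6)"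
    unfolding s_def by algebra
  also have "33 * t\<^sup>2 + (1 - t\<^sup>2) * (33 - (1 - s) * (12 * (norm c - 3/2)\<^sup>2 + 6))
      \<le> 33 * t\<^sup>2 + (1 - t\<^sup>2) * 33"
    using s tt by (intro add_left_mono mult_left_mono) auto
  finally have "norm (288 * hankel_in_schwarz_coeffs c (q * x) (q * (y - cnj c * x\<^sup>2))) \<le> 33"
    unfolding eq by simp
  thus ?thesis by (simp add: norm_mult)
qed

section \<open>Covering the quarter disc\<close>

text \<open>
  Near the origin the function is \<open>1 + 2 z + 3/2 z\<^sup>2 + O(z\<^sup>3)\<close>, and the quadratic part already has real
  part at least \<open>1 - 2 \<bar>z\<bar> + \<bar>z\<bar>\<^sup>2\<close> for \<open>\<bar>z\<bar> \<le> 1/2\<close>. The slack \<open>\<bar>z\<bar>\<^sup>2\<close> absorbs the remainder. The bound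
  \<open>1 - 2 r\<close> is chosen because its integral over \<open>[0, 1/2]\<close> is exactly \<open>1/4\<close>.
\<close>
lemma Re_exp_times_one_plus_sin_ge:
  fixes z :: complex
  assumes z: "norm z \<le> 1/2"
  shows "1 - 2 * norm z \<le> Re (exp z * (1 + sin z))"
proof -
  \<comment> \<open>The derivatives of orders 0 to 4 of \<open>exp w * (1 + sin w)\<close>.\<close>
  define D :: "nat \<Rightarrow> complex \<Rightarrow> complex" where
    "D i w = exp w * (if i = 0 then 1 + sin w else if i = 1 then 1 + sin w + cos w
       else if i = 2 then 1 + 2 * cos w else if i = 3 then 1 + 2 * cos w - 2 * sin w
       else 1 - 4 * sin w)" for i w
  have exp_le: "norm (exp w) \<le> 2" if "norm w \<le> 1/2" for w :: complex
  proof -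
    have "Re w \<le> 1/2" using complex_Re_le_cmod[of w] that by linarith
    hence "exp (Re w) \<le> exp (1/2)" by simp
    thus ?thesis using exp_half_le2 by (simp only: norm_exp_eq_Re)
  qed
  have sin_le: "norm (sin w) \<le> 2" if "norm w \<le> 1/2" for w :: complex
  proof -
    have "norm (exp (\<i> * w) - exp (- (\<i> * w))) \<le> 2 + 2"
      using that by (intro norm_triangle_le_diff add_mono exp_le) (auto simp: norm_mult)
    thus ?thesis by (simp add: sin_exp_eq norm_divide norm_mult)
  qed
  define s where "s = norm z"
  have s: "0 \<le> s" "s \<le> 1/2" using z by (auto simp: s_def)
  have "norm (D 0 z - (\<Sum>i\<le>3. D i 0 * (z - 0) ^ i / fact i)) \<le> 18 * norm (z - 0) ^ Suc 3 / fact 3"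
  proof (rule complex_Taylor[of "cball 0 (1/2)" 3 D 18])
    fix i :: nat and w :: complex assume "w \<in> cball 0 (1/2)" "i \<le> 3"
    hence "i \<in> {0::nat,1,2,3}" by auto
    thus "(D i has_field_derivative D (Suc i) w) (at w within cball 0 (1/2))"
      unfolding D_def
      by (elim insertE emptyE) (auto intro!: derivative_eq_intros simp: algebra_simps)
  next
    fix w :: complex assume w: "w \<in> cball 0 (1/2)"
    have "norm (1 - 4 * sin w) \<le> 1 + 4 * 2"
      using sin_le[of w] w by (intro norm_triangle_le_diff add_mono) (auto simp: norm_mult)
    hence "norm (exp w) * norm (1 - 4 * sin w) \<le> 2 * 9"
      using exp_le[of w] w by (intro mult_mono) auto
    thus "norm (D (Suc 3) w) \<le> 18" by (simp add: D_def norm_mult)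
  qed (use z in auto)
  hence T: "norm (exp z * (1 + sin z) - (1 + 2 * z + 3/2 * z\<^sup>2 + z ^ 3 / 2)) \<le> 3 * s ^ 4"
    by (simp add: D_def s_def eval_nat_numeral algebra_simps)
  have "Re (1 + 2 * z + 3/2 * z\<^sup>2) - Re (exp z * (1 + sin z))
      \<le> norm ((1 + 2 * z + 3/2 * z\<^sup>2) - exp z * (1 + sin z))"
    using complex_Re_le_cmod[of "(1 + 2 * z + 3/2 * z\<^sup>2) - exp z * (1 + sin z)"] by simp
  also have "\<dots> = norm ((exp z * (1 + sin z) - (1 + 2 * z + 3/2 * z\<^sup>2 + z ^ 3 / 2)) + z ^ 3 / 2)"
    by (subst norm_minus_commute) (simp add: algebra_simps)
  also have "\<dots> \<le> 3 * s ^ 4 + s ^ 3 / 2"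
    using T by (intro norm_triangle_le add_mono) (auto simp: s_def norm_divide norm_power)
  also have "\<dots> = s\<^sup>2 * (3 * s\<^sup>2 + s / 2)"
    by (simp add: eval_nat_numeral algebra_simps)
  also have "\<dots> \<le> s\<^sup>2 * (3 * (1/2)\<^sup>2 + (1/2) / 2)"
    using s by (intro mult_left_mono add_mono power_mono) auto
  finally have "Re (1 + 2 * z + 3/2 * z\<^sup>2) - s\<^sup>2 \<le> Re (exp z * (1 + sin z))"
    by (simp add: power2_eq_square)
  moreover define x where "x = Re z"
  have x: "- s \<le> x" "x \<le> s" using abs_Re_le_cmod[of z] by (auto simp: x_def s_def)
  have "Re (1 + 2 * z + 3/2 * z\<^sup>2) = 1 + 2 * x + 3 * x\<^sup>2 - 3/2 * s\<^sup>2"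
    unfolding s_def cmod_power2 x_def by (simp add: power2_eq_square field_simps)
  moreover have "0 \<le> 2 * x + 3 * x\<^sup>2 + 2 * s - 5/2 * s\<^sup>2"
  proof (cases "s \<ge> 3/10")
    case True
    have "0 \<le> 3 * (x + 1/3)\<^sup>2" by simp
    hence "0 \<le> 3 * x\<^sup>2 + 2 * x + 1/3" by (simp add: power2_eq_square algebra_simps)
    moreover have "0 \<le> (s - 3/10) * (1/2 - s)" using True s by simp
    hence "0 \<le> 4/5 * s - s\<^sup>2 - 3/20" by (simp add: power2_eq_square field_simps)
    ultimately show ?thesis by linarith
  next
    case False
    hence "0 \<le> x + s" "0 \<le> 2 + 3 * (x - s)" using x by auto
    hence "0 \<le> (x + s) * (2 + 3 * (x - s))" by (rule mult_nonneg_nonneg)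
    hence "0 \<le> (x + s) * (2 + 3 * (x - s)) + s\<^sup>2 / 2" by simp
    thus ?thesis by (simp add: power2_eq_square algebra_simps)
  qed
  ultimately show ?thesis unfolding s_def[symmetric] by linarith
qed

lemma class_P_starE:
  assumes "f \<in> class_P_star"
  obtains \<omega> where "f holomorphic_on ball 0 1" "inj_on f (ball 0 1)" "f 0 = 0" "deriv f 0 = 1"
    "schwarz_function \<omega>" "\<And>z. norm z < 1 \<Longrightarrow> deriv f z = exp (\<omega> z) * (1 + sin (\<omega> z))"
  using assms by (auto simp: class_P_star_def class_S_def subordinate_def)

text \<open>
  The Schwarz lemma gives \<open>\<bar>\<omega> (t z)\<bar> \<le> t / 2\<close>, hence \<open>Re (f' (t z)) \<ge> 1 - t\<close>. Integrating this along the
  radius yields \<open>Re (f z / z) \<ge> 1/2\<close>.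
\<close>
lemma class_P_star_norm_ge_quarter:
  assumes f: "f \<in> class_P_star" and z: "norm z = 1/2"
  shows "1/4 \<le> norm (f z)"
proof -
  from f obtain \<omega> where holf: "f holomorphic_on ball 0 1" and f0: "f 0 = 0"
    and \<omega>: "schwarz_function \<omega>" and df: "\<And>z. norm z < 1 \<Longrightarrow> deriv f z = exp (\<omega> z) * (1 + sin (\<omega> z))"
    using class_P_starE by blast
  define G where "G t = Re (f (of_real t * z) / z) - (t - t\<^sup>2 / 2)" for t
  have "G 0 \<le> G 1"
  proof (rule DERIV_nonneg_imp_nondecreasing[of 0 1 G])
    fix t :: real assume t: "0 \<le> t" "t \<le> 1"
    have tz: "norm (of_real t * z) = t / 2" using t z by (simp add: norm_mult)
    hence tz1: "of_real t * z \<in> ball 0 1" using t by simp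
    have "norm (\<omega> (of_real t * z)) \<le> t / 2"
      using Schwarz_Lemma(1)[of \<omega> "of_real t * z"] \<omega> tz1 tz
      by (auto simp: schwarz_function_def)
    moreover from this have "1 - 2 * norm (\<omega> (of_real t * z)) \<le> Re (deriv f (of_real t * z))"
      using Re_exp_times_one_plus_sin_ge[of "\<omega> (of_real t * z)"] t tz1 by (simp add: df)
    ultimately have ge: "1 - t \<le> Re (deriv f (of_real t * z))"
      by linarith
    have "(f has_field_derivative deriv f (of_real t * z)) (at (of_real t * z))"
      using holf tz1 by (intro holomorphic_derivI) auto
    hence "((f \<circ> (\<lambda>t. of_real t * z)) has_vector_derivative z * deriv f (of_real t * z)) (at t)"
      by (intro field_vector_diff_chain_at) (auto intro!: derivative_eq_intros simp: has_vector_derivative_def scaleR_conv_of_real)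
    hence "((\<lambda>t. f (of_real t * z) / z) has_vector_derivative deriv f (of_real t * z)) (at t)"
      using z by (auto simp: o_def intro!: derivative_eq_intros)
    hence "((\<lambda>t. Re (f (of_real t * z) / z)) has_real_derivative Re (deriv f (of_real t * z))) (at t)"
      unfolding has_real_derivative_iff_has_vector_derivative
      by (rule bounded_linear.has_vector_derivative[OF bounded_linear_Re])
    hence "(G has_real_derivative Re (deriv f (of_real t * z)) - (1 - t)) (at t)"
      unfolding G_def by (rule DERIV_diff) (auto intro!: derivative_eq_intros)
    thus "\<exists>y. (G has_real_derivative y) (at t) \<and> 0 \<le> y"
      using ge by auto
  qed simp
  hence "1/2 \<le> Re (f z / z)" using f0 by (simp add: G_def)
  also have "\<dots> \<le> norm (f z / z)" by (rule complex_Re_le_cmod)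
  finally show ?thesis using z by (simp add: norm_divide)
qed

text \<open>
  For this class the Koebe disc is reached inside \<open>\<bar>z\<bar> < 1/2\<close>: the part of the image of that disc which
  lies in \<open>\<bar>w\<bar> < 1/4\<close> is open by the open mapping theorem, and relatively closed since the circle
  \<open>\<bar>z\<bar> = 1/2\<close> is mapped outside. It is therefore everything.
\<close>
lemma class_P_star_covers_quarter_disc:
  assumes f: "f \<in> class_P_star"
  shows "ball 0 (1/4) \<subseteq> f ` ball 0 1"
proof -
  have holf: "f holomorphic_on ball 0 1" and f0: "f 0 = 0" and inj: "inj_on f (ball 0 1)"
    using f by (auto simp: class_P_star_def class_S_def)
  define S where "S = ball 0 (1/4) \<inter> f ` ball 0 (1/2)"
  have "S = ball 0 (1/4) \<inter> f ` cball 0 (1/2)"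
  proof -
    have "w \<in> ball 0 (1/2)" if "w \<in> cball 0 (1/2)" "f w \<in> ball 0 (1/4)" for w
      using class_P_star_norm_ge_quarter[OF f, of w] that by (cases "norm w = 1/2") auto
    thus ?thesis unfolding S_def by auto
  qed
  moreover have "compact (f ` cball 0 (1/2))"
    by (intro compact_continuous_image holomorphic_on_imp_continuous_on
          holomorphic_on_subset[OF holf]) auto
  ultimately have "closedin (top_of_set (ball 0 (1/4))) S"
    by (auto intro!: closedin_closed_Int compact_imp_closed)
  moreover have "open (f ` ball 0 (1/2))"
    by (rule open_mapping_thm3[OF holomorphic_on_subset[OF holf]])
       (auto intro: inj_on_subset[OF inj])
  hence "openin (top_of_set (ball 0 (1/4))) S"
    unfolding S_def by (intro openin_open_Int)
  moreover have "S \<noteq> {}"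
  proof -
    have "f 0 \<in> f ` ball 0 (1/2)" by (rule imageI) simp
    hence "0 \<in> S" using f0 by (simp add: S_def)
    thus ?thesis by blast
  qed
  ultimately have "S = ball 0 (1/4)"
    using connected_clopen[of "ball (0::complex) (1/4)"] by auto
  hence "ball 0 (1/4) \<subseteq> f ` ball 0 (1/2)" by (auto simp only: S_def)
  also have "\<dots> \<subseteq> f ` ball 0 1" by (intro image_mono) auto
  finally show ?thesis .
qed

section \<open>Logarithmic inverse coefficients\<close>

text \<open>
  With \<open>g\<close> the inverse of \<open>f\<close>, the quotient \<open>g w / w\<close> extends to a zero-free holomorphic function on a
  convex set, with value \<open>1\<close> at the origin, so it has a logarithm, normalised by subtracting its value
  at \<open>0\<close>.
\<close>
lemma log_inverse_branch_exists:
  assumes f: "f \<in> class_S" and cover: "ball 0 (1/4) \<subseteq> f ` ball 0 1"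
  obtains F where "log_inverse_branch f F"
proof -
  have holf: "f holomorphic_on ball 0 1" and inj: "inj_on f (ball 0 1)"
    and f0: "f 0 = 0" and df0: "deriv f 0 = 1"
    using f by (auto simp: class_S_def)
  obtain g where g: "g holomorphic_on f ` ball 0 1"
      "\<And>z. z \<in> ball 0 1 \<Longrightarrow> deriv f z * deriv g (f z) = 1" "\<And>z. z \<in> ball 0 1 \<Longrightarrow> g (f z) = z"
    using holomorphic_has_inverse[OF holf open_ball inj] by blast
  have g_inv: "the_inv_into (ball 0 1) f w = g w" and fg: "f (g w) = w" if "w \<in> ball 0 (1/4)" for w
    using that cover g(3) the_inv_into_f_f[OF inj] by (auto dest!: subsetD)
  have g0: "g 0 = 0" "deriv g 0 = 1"
    using g(2)[of 0] g(3)[of 0] f0 df0 by auto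
  obtain h where h: "h holomorphic_on ball 0 (1/4)" "\<And>w. norm w < 1/4 \<Longrightarrow> g w = w * h w"
      "deriv g 0 = h 0"
    using Schwarz3[OF holomorphic_on_subset[OF g(1) cover] g0(1)] by blast
  have h_nz: "h w \<noteq> 0" if "w \<in> ball 0 (1/4)" for w
  proof
    assume "h w = 0"
    hence "g w = 0" using h(2)[of w] that by simp
    hence "w = 0" using fg[OF that] f0 by simp
    thus False using \<open>h w = 0\<close> h(3) g0 by simp
  qed
  obtain L where L: "L holomorphic_on ball 0 (1/4)" "\<And>w. w \<in> ball 0 (1/4) \<Longrightarrow> h w = exp (L w)"
    using contractible_imp_holomorphic_log[OF h(1) convex_imp_contractible[OF convex_ball] h_nz]
    by blast
  have expL0: "exp (L 0) = 1"
    using L(2)[of 0] h(3) g0(2) by simp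
  have "log_inverse_branch f (\<lambda>w. L w - L 0)"
    unfolding log_inverse_branch_def
  proof (intro conjI ballI)
    fix w :: complex assume w: "w \<in> ball 0 (1/4) - {0}"
    thus "exp (L w - L 0) = the_inv_into (ball 0 1) f w / w"
      using L(2)[of w] h(2)[of w] g_inv[of w] by (simp add: exp_diff expL0)
  qed (auto intro!: holomorphic_intros L)
  thus thesis by (rule that)
qed

text \<open>
  The exponential of the difference of two branches is constantly \<open>1\<close>; hence the derivative of the
  difference vanishes, and both branches agree at \<open>0\<close>.
\<close>
lemma log_inverse_branch_unique:
  assumes F: "log_inverse_branch f F" and G: "log_inverse_branch f G" and w: "w \<in> ball 0 (1/4)"
  shows "F w = G w"
proof -
  define D where "D w = F w - G w" for w
  have hol: "D holomorphic_on ball 0 (1/4)"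
    unfolding D_def using F G by (auto intro!: holomorphic_intros simp: log_inverse_branch_def)
  have exp1: "exp (D w) = 1" if "w \<in> ball 0 (1/4)" for w
  proof -
    have "exp (F w) = exp (G w)"
      using F G that by (cases "w = 0") (auto simp: log_inverse_branch_def)
    thus ?thesis by (simp add: D_def exp_diff)
  qed
  have "(D has_field_derivative 0) (at w within ball 0 (1/4))" if w: "w \<in> ball 0 (1/4)" for w
  proof -
    have D: "(D has_field_derivative deriv D w) (at w)"
      using hol w by (intro holomorphic_derivI) auto
    have "((\<lambda>w. exp (D w)) has_field_derivative exp (D w) * deriv D w) (at w)"
      by (rule DERIV_chain'[OF D DERIV_exp])
    moreover have "((\<lambda>w. exp (D w)) has_field_derivative 0) (at w)"
      by (rule has_field_derivative_transform_within_open[of "\<lambda>_. 1" _ _ "ball 0 (1/4)"])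
         (use w exp1 in auto)
    ultimately have "deriv D w = 0"
      using DERIV_unique by fastforce
    thus ?thesis using D by (simp add: has_field_derivative_at_within)
  qed
  then obtain c where c: "\<And>w. w \<in> ball 0 (1/4) \<Longrightarrow> D w = c"
    using has_field_derivative_zero_constant[OF convex_ball] by metis
  have "D 0 = 0" using F G by (simp add: D_def log_inverse_branch_def)
  thus ?thesis using c[of 0] c[OF w] by (simp add: D_def)
qed

lemma log_inverse_coeff_eq:
  assumes F: "log_inverse_branch f F" and L: "F has_fps_expansion L"
  shows "log_inverse_coeff f = (\<lambda>n. fps_nth L n / 2)"
  unfolding log_inverse_coeff_def
proof (rule the_equality, intro conjI exI ballI)
  have hol: "F holomorphic_on ball 0 (1/4)" and F0: "F 0 = 0"
    using F by (auto simp: log_inverse_branch_def)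
  note Ln = fps_nth_fps_expansion[OF L]
  show L0: "fps_nth L 0 / 2 = 0" using Ln[of 0] F0 by simp
  show "log_inverse_branch f F" by fact
  fix w :: complex assume w: "w \<in> ball 0 (1/4)"
  have "(\<lambda>n. fps_nth L n * w ^ n) sums F w"
    using holomorphic_power_series[OF hol w] by (simp add: Ln)
  hence "(\<lambda>n. fps_nth L (Suc n) * w ^ Suc n) sums F w"
    using L0 by (subst sums_Suc_iff) simp
  thus "(\<lambda>n. 2 * (fps_nth L (Suc n) / 2) * w ^ Suc n) sums F w"
    by simp
next
  fix \<Gamma> :: "nat \<Rightarrow> complex"
  assume "\<Gamma> 0 = 0 \<and> (\<exists>G. log_inverse_branch f G \<and>
    (\<forall>w\<in>ball 0 (1/4). (\<lambda>n. 2 * \<Gamma> (Suc n) * w ^ Suc n) sums G w))"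
  then obtain G where \<Gamma>0: "\<Gamma> 0 = 0" and G: "log_inverse_branch f G"
    "\<And>w. w \<in> ball 0 (1/4) \<Longrightarrow> (\<lambda>n. 2 * \<Gamma> (Suc n) * w ^ Suc n) sums G w"
    by blast
  have "F has_fps_expansion Abs_fps (\<lambda>n. 2 * \<Gamma> n)"
  proof (rule has_fps_expansionI, rule eventually_mono)
    show "eventually (\<lambda>w::complex. w \<in> ball 0 (1/4)) (nhds 0)"
      by (intro eventually_nhds_in_open) auto
  next
    fix w :: complex assume w: "w \<in> ball 0 (1/4)"
    have "(\<lambda>n. 2 * \<Gamma> (Suc n) * w ^ Suc n) sums F w"
      using G(2)[OF w] log_inverse_branch_unique[OF F G(1) w] by simp
    hence "(\<lambda>n. 2 * \<Gamma> n * w ^ n) sums F w"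
      using sums_Suc_iff[of "\<lambda>n. 2 * \<Gamma> n * w ^ n" "F w"] \<Gamma>0 by simp
    thus "(\<lambda>n. fps_nth (Abs_fps (\<lambda>n. 2 * \<Gamma> n)) n * w ^ n) sums F w" by simp
  qed
  hence "L = Abs_fps (\<lambda>n. 2 * \<Gamma> n)"
    by (rule fps_expansion_unique_complex[OF L])
  thus "\<Gamma> = (\<lambda>n. fps_nth L n / 2)" by simp
qed

text \<open>
  Substituting \<open>w = f z\<close> in the definition of the branch gives \<open>exp (F (f z)) * f z = z\<close>. Differentiating
  and multiplying by \<open>f z\<close> eliminates the exponential, which leaves an equation from which the
  coefficients of \<open>L oo A\<close> can be read off one after the other.
\<close>
lemma log_inverse_fps_equation:
  assumes f: "f \<in> class_S" and cover: "ball 0 (1/4) \<subseteq> f ` ball 0 1"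
    and A: "f has_fps_expansion A" and F: "log_inverse_branch f F" and L: "F has_fps_expansion L"
  shows "fps_X * (fps_deriv (L oo A) * A + fps_deriv A) = A"
proof -
  have holf: "f holomorphic_on ball 0 1" and inj: "inj_on f (ball 0 1)" and f0: "f 0 = 0"
    using f by (auto simp: class_S_def)
  have A0: "fps_nth A 0 = 0" using fps_nth_fps_expansion[OF A, of 0] f0 by simp
  have L0: "fps_nth L 0 = 0"
    using fps_nth_fps_expansion[OF L, of 0] F by (simp add: log_inverse_branch_def)
  have LA0: "fps_nth (L oo A) 0 = 0" using L0 by simp
  define E where "E = fps_exp 1 oo (L oo A)"
  have "continuous (at 0) f"
    using holf by (auto simp: continuous_on_eq_continuous_at dest!: holomorphic_on_imp_continuous_on)
  hence "(f \<longlongrightarrow> 0) (nhds 0)"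
    using f0 by (auto simp: isCont_def tendsto_nhds_iff)
  hence ev: "eventually (\<lambda>z. f z \<in> ball 0 (1/4)) (nhds 0)"
    by (rule topological_tendstoD) auto
  have ev1: "eventually (\<lambda>z::complex. z \<in> ball 0 1) (nhds 0)"
    by (intro eventually_nhds_in_open) auto
  have "(\<lambda>z. (exp \<circ> (F \<circ> f)) z * f z) has_fps_expansion E * A"
    unfolding E_def by (intro fps_expansion_intros A L A0 LA0)
  also have "?this \<longleftrightarrow> (\<lambda>z. z) has_fps_expansion E * A"
  proof (intro has_fps_expansion_cong refl eventually_mono[OF eventually_conj[OF ev ev1]])
    fix z assume z: "f z \<in> ball 0 (1/4) \<and> z \<in> ball 0 1"
    show "(exp \<circ> (F \<circ> f)) z * f z = z"
    proof (cases "z = 0")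
      case False
      hence "f z \<noteq> 0" using inj_onD[OF inj, of z 0] z f0 by auto
      thus ?thesis using F z the_inv_into_f_f[OF inj, of z] by (simp add: log_inverse_branch_def)
    qed (use f0 in auto)
  qed
  finally have EA: "E * A = fps_X"
    by (rule fps_expansion_unique_complex) (rule fps_expansion_intros)
  have "fps_deriv E = E * fps_deriv (L oo A)"
    unfolding E_def by (subst fps_compose_deriv[OF LA0]) simp
  hence "fps_deriv (E * A) = E * (fps_deriv (L oo A) * A + fps_deriv A)"
    by (simp add: algebra_simps)
  hence "1 = E * (fps_deriv (L oo A) * A + fps_deriv A)"
    unfolding EA by simp
  hence "A * 1 = A * (E * (fps_deriv (L oo A) * A + fps_deriv A))" by simp
  thus ?thesis using EA by (simp add: mult.assoc[symmetric] mult.commute[of A E])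
qed

lemma log_inverse_coeffs_low:
  assumes f: "f \<in> class_S" and cover: "ball 0 (1/4) \<subseteq> f ` ball 0 1"
    and A: "f has_fps_expansion A"
  defines "a \<equiv> fps_nth A"
  shows "log_inverse_coeff f 1 = - (1/2) * a 2"
    and "log_inverse_coeff f 2 = - (1/2) * a 3 + 3/4 * (a 2)\<^sup>2"
    and "log_inverse_coeff f 3 = - (1/2) * (a 4 - 4 * a 2 * a 3 + 10/3 * a 2 ^ 3)"
proof -
  obtain F where F: "log_inverse_branch f F"
    by (rule log_inverse_branch_exists[OF f cover])
  define L where "L = fps_expansion F 0"
  have L: "F has_fps_expansion L"
    unfolding L_def by (rule has_fps_expansion_fps_expansion[of "ball 0 (1/4)"])
      (use F in \<open>auto simp: log_inverse_branch_def\<close>)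
  define M where "M = L oo A"
  have eq: "fps_X * (fps_deriv M * A + fps_deriv A) = A"
    unfolding M_def by (rule log_inverse_fps_equation[OF f cover A F L])
  have A01: "fps_nth A 0 = 0" "fps_nth A (Suc 0) = 1"
    using fps_nth_fps_expansion[OF A, of 0] fps_nth_fps_expansion[OF A, of 1] f
    by (auto simp: class_S_def)
  have "fps_nth (fps_X * (fps_deriv M * A + fps_deriv A)) n = fps_nth A n" for n
    by (simp only: eq)
  note nth = this[of 2] this[of 3] this[of 4]
  note M = fps_compose_nth[of L A, folded M_def]
  have M1: "fps_nth M 1 = fps_nth L 1"
    and M2: "fps_nth M 2 = fps_nth L 1 * a 2 + fps_nth L 2"
    and M3: "fps_nth M 3 = fps_nth L 1 * a 3 + 2 * fps_nth L 2 * a 2 + fps_nth L 3"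
    by (simp_all add: M a_def eval_nat_numeral fps_mult_nth A01)
  have N1: "fps_nth M 1 + 2 * a 2 = a 2"
    and N2: "fps_nth M 1 * a 2 + 2 * fps_nth M 2 + 3 * a 3 = a 3"
    and N3: "fps_nth M 1 * a 3 + 2 * fps_nth M 2 * a 2 + 3 * fps_nth M 3 + 4 * a 4 = a 4"
    using nth by (simp_all add: a_def eval_nat_numeral fps_mult_nth A01 algebra_simps)
  have L1: "fps_nth L 1 = - a 2"
    using N1 M1 by (simp add: eq_neg_iff_add_eq_0 algebra_simps)
  have L2: "fps_nth L 2 = - a 3 + 3/2 * (a 2)\<^sup>2"
    using N2 M2 unfolding M1 L1 by (simp add: power2_eq_square) algebra
  have L3: "fps_nth L 3 = - a 4 + 4 * a 2 * a 3 - 10/3 * a 2 ^ 3"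
    using N3 unfolding M3 M2 M1 L1 L2 by (simp add: power2_eq_square) algebra
  show "log_inverse_coeff f 1 = - (1/2) * a 2"
    and "log_inverse_coeff f 2 = - (1/2) * a 3 + 3/4 * (a 2)\<^sup>2"
    and "log_inverse_coeff f 3 = - (1/2) * (a 4 - 4 * a 2 * a 3 + 10/3 * a 2 ^ 3)"
    unfolding log_inverse_coeff_eq[OF F L] L1 L2 L3 by (simp_all add: field_simps)
qed

section \<open>Univalence of the extremal function\<close>

text \<open>
  The function \<open>exp (- u\<^sup>2 / 2) * cosh u\<close> decreases for \<open>u \<ge> 0\<close>, because \<open>sinh u \<le> u * cosh u\<close>.
\<close>
lemma cosh_le_exp_half_square: "cosh (y::real) \<le> exp (y\<^sup>2 / 2)"
proof -
  have sinh_le: "sinh u \<le> u * cosh u" if "0 \<le> u" for u :: real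
  proof -
    have "0 * cosh 0 - sinh 0 \<le> u * cosh u - sinh u"
    proof (rule DERIV_nonneg_imp_nondecreasing[OF that])
      fix x :: real assume x: "0 \<le> x" "x \<le> u"
      have "((\<lambda>x. x * cosh x - sinh x) has_real_derivative x * sinh x) (at x)"
        by (auto intro!: derivative_eq_intros)
      thus "\<exists>y. ((\<lambda>x. x * cosh x - sinh x) has_real_derivative y) (at x) \<and> 0 \<le> y"
        using x by auto
    qed
    thus ?thesis by simp
  qed
  have *: "cosh u \<le> exp (u\<^sup>2 / 2)" if "0 \<le> u" for u :: real
  proof -
    have "exp (- (u\<^sup>2 / 2)) * cosh u \<le> exp (- (0\<^sup>2 / 2)) * cosh (0::real)"
    proof (rule DERIV_nonpos_imp_nonincreasing[OF that])
      fix x :: real assume x: "0 \<le> x" "x \<le> u"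
      have "((\<lambda>x. exp (- (x\<^sup>2 / 2)) * cosh x) has_real_derivative
              exp (- (x\<^sup>2 / 2)) * (sinh x - x * cosh x)) (at x)"
        by (auto intro!: derivative_eq_intros simp: algebra_simps)
      moreover have "exp (- (x\<^sup>2 / 2)) * (sinh x - x * cosh x) \<le> 0"
        using sinh_le[OF x(1)] by (simp add: mult_le_0_iff)
      ultimately show "\<exists>y. ((\<lambda>x. exp (- (x\<^sup>2 / 2)) * cosh x) has_real_derivative y) (at x) \<and> y \<le> 0"
        by blast
    qed
    thus ?thesis by (simp add: exp_minus field_simps)
  qed
  from *[of "\<bar>y\<bar>"] show ?thesis by (simp add: cosh_real_abs)
qed

text \<open>
  For \<open>z = x + i y\<close> the real part of \<open>sin z\<close> is \<open>sin x cosh y\<close>, and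
  \<open>\<bar>sin x\<bar> cosh y \<le> \<bar>x\<bar> exp (y\<^sup>2 / 2) < \<bar>x\<bar> exp ((1 - x\<^sup>2) / 2) \<le> 1\<close> for \<open>x \<noteq> 0\<close>; the last step is
  \<open>x\<^sup>2 \<le> exp (x\<^sup>2 - 1)\<close>.
\<close>
lemma Re_one_plus_sin_pos:
  assumes z: "norm z < 1"
  shows "0 < Re (1 + sin z)"
proof -
  define x y where "x = Re z" and "y = Im z"
  have xy: "x\<^sup>2 + y\<^sup>2 < 1"
    using z cmod_power2[of z] power_strict_mono[of "norm z" 1 2] by (simp add: x_def y_def)
  have "\<bar>sin x\<bar> * cosh y < 1"
  proof (cases "x = 0")
    case False
    have "\<bar>sin x\<bar> * cosh y \<le> \<bar>x\<bar> * exp (y\<^sup>2 / 2)"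
      by (intro mult_mono abs_sin_x_le_abs_x cosh_le_exp_half_square) auto
    also have "\<dots> < \<bar>x\<bar> * exp ((1 - x\<^sup>2) / 2)"
      using False xy by simp
    also have "\<dots> \<le> 1"
    proof (rule power2_le_imp_le)
      have "x\<^sup>2 \<le> exp (x\<^sup>2 - 1)" using exp_ge_add_one_self[of "x\<^sup>2 - 1"] by simp
      hence "x\<^sup>2 * exp (1 - x\<^sup>2) \<le> exp (x\<^sup>2 - 1) * exp (1 - x\<^sup>2)"
        by (intro mult_right_mono) auto
      moreover have "(exp ((1 - x\<^sup>2) / 2))\<^sup>2 = exp (1 - x\<^sup>2)"
        by (simp add: exp_double[symmetric] diff_divide_distrib)
      ultimately show "(\<bar>x\<bar> * exp ((1 - x\<^sup>2) / 2))\<^sup>2 \<le> 1\<^sup>2"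
        by (simp add: power_mult_distrib flip: exp_add)
    qed auto
    finally show ?thesis .
  qed auto
  hence "\<bar>sin x * cosh y\<bar> < 1" by (simp add: abs_mult)
  moreover have "Re (sin z) = sin x * cosh y"
    by (simp add: Re_sin x_def y_def cosh_field_def)
  ultimately show ?thesis by (simp add: abs_less_iff)
qed

lemma Re_segment_pos:
  fixes a b :: complex
  assumes "0 < Re a" "0 < Re b" "0 \<le> t" "t \<le> 1"
  shows "0 < Re (of_real (1 - t) * a + of_real t * b)"
proof (cases "t = 0")
  case False
  hence "0 < t * Re b" "0 \<le> (1 - t) * Re a" using assms by auto
  thus ?thesis by simp
qed (use assms in auto)

text \<open>
  Along a segment \<open>w\<close>, the logarithm \<open>\<gamma> = Ln w\<close> satisfies \<open>\<gamma>'' = - \<gamma>'\<^sup>2\<close>, so the second derivative of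
  \<open>\<bar>\<gamma>\<bar>\<^sup>2\<close> is \<open>2 (\<bar>\<gamma>'\<bar>\<^sup>2 - Re (cnj \<gamma> \<gamma>'\<^sup>2)) \<ge> 2 \<bar>\<gamma>'\<bar>\<^sup>2 (1 - \<bar>\<gamma>\<bar>)\<close>. As long as \<open>\<bar>\<gamma>\<bar> \<le> 1\<close>, the function
  \<open>\<bar>\<gamma>\<bar>\<^sup>2\<close> is convex and stays below the larger of its end values.
\<close>
lemma norm_Ln_segment_less_1:
  fixes a b :: complex
  assumes a: "0 < Re a" "norm (Ln a) < 1" and b: "0 < Re b" "norm (Ln b) < 1"
    and le: "\<And>t. 0 \<le> t \<Longrightarrow> t \<le> 1 \<Longrightarrow> norm (Ln (of_real (1 - t) * a + of_real t * b)) \<le> 1"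
    and t: "0 \<le> t" "t \<le> 1"
  shows "norm (Ln (of_real (1 - t) * a + of_real t * b)) < 1"
proof -
  define w where "w t = of_real (1 - t) * a + of_real t * b" for t
  define e where "e = b - a"
  define p where "p t = e / w t" for t
  define N where "N t = (Re (Ln (w t)))\<^sup>2 + (Im (Ln (w t)))\<^sup>2" for t
  have N: "N t = (norm (Ln (w t)))\<^sup>2" for t by (simp add: N_def cmod_power2)
  have dw: "(w has_vector_derivative e) (at x)" for x
    unfolding w_def e_def by (auto intro!: derivative_eq_intros simp: algebra_simps)
  have w: "0 < Re (w x)" if "x \<in> {0..1}" for x
    unfolding w_def using Re_segment_pos[OF a(1) b(1)] that by auto
  have dLn: "((\<lambda>t. Ln (w t)) has_vector_derivative p x) (at x)" if "x \<in> {0..1}" for x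
  proof -
    have "w x \<notin> \<real>\<^sub>\<le>\<^sub>0" using w[OF that] by (auto simp: complex_nonpos_Reals_iff)
    hence "(Ln has_field_derivative inverse (w x)) (at (w x))" by (rule has_field_derivative_Ln)
    from field_vector_diff_chain_at[OF dw this] show ?thesis
      by (simp add: o_def p_def field_simps)
  qed
  have dp: "(p has_vector_derivative - (p x)\<^sup>2) (at x)" if "x \<in> {0..1}" for x
  proof -
    have "w x \<noteq> 0" using w[OF that] by auto
    hence "((\<lambda>u. e / u) has_field_derivative - e / (w x)\<^sup>2) (at (w x))"
      by (auto intro!: derivative_eq_intros simp: power2_eq_square)
    from field_vector_diff_chain_at[OF dw this] show ?thesis
      by (simp add: o_def p_def[abs_def] power2_eq_square)
  qed
  have Re_d: "((\<lambda>t. Re (g t)) has_real_derivative Re g') (at x)"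
    and Im_d: "((\<lambda>t. Im (g t)) has_real_derivative Im g') (at x)"
    if "(g has_vector_derivative g') (at x)" for g :: "real \<Rightarrow> complex" and g' x
    using bounded_linear.has_vector_derivative[OF bounded_linear_Re that]
      bounded_linear.has_vector_derivative[OF bounded_linear_Im that]
    by (simp_all add: has_real_derivative_iff_has_vector_derivative)
  have "convex_on {0..1} N"
  proof (rule f''_ge0_imp_convex)
    fix x :: real assume x: "x \<in> {0..1}"
    show "(N has_real_derivative
        2 * Re (Ln (w x)) * Re (p x) + 2 * Im (Ln (w x)) * Im (p x)) (at x)"
      unfolding N_def
      by (rule Re_d[OF dLn[OF x]] Im_d[OF dLn[OF x]] derivative_eq_intros refl)+ simp
    show "((\<lambda>x. 2 * Re (Ln (w x)) * Re (p x) + 2 * Im (Ln (w x)) * Im (p x)) has_real_derivative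
        2 * ((norm (p x))\<^sup>2 - Re (cnj (Ln (w x)) * (p x)\<^sup>2))) (at x)"
      unfolding cmod_power2
      by (rule Re_d[OF dLn[OF x]] Im_d[OF dLn[OF x]] Re_d[OF dp[OF x]] Im_d[OF dp[OF x]]
               derivative_eq_intros refl)+
         (simp add: power2_eq_square algebra_simps)
    have "Re (cnj (Ln (w x)) * (p x)\<^sup>2) \<le> norm (cnj (Ln (w x)) * (p x)\<^sup>2)"
      by (rule complex_Re_le_cmod)
    also have "\<dots> \<le> 1 * (norm (p x))\<^sup>2"
      unfolding norm_mult norm_power complex_mod_cnj
      by (intro mult_right_mono) (use le x in \<open>auto simp: w_def\<close>)
    finally show "0 \<le> 2 * ((norm (p x))\<^sup>2 - Re (cnj (Ln (w x)) * (p x)\<^sup>2))" by simp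
  qed auto
  hence "N ((1 - t) *\<^sub>R 0 + t *\<^sub>R 1) \<le> (1 - t) * N 0 + t * N 1"
    using t by (intro convex_onD) auto
  hence "N t \<le> (1 - t) * N 0 + t * N 1" by simp
  also have "\<dots> < 1"
  proof -
    have "N 0 < 1" "N 1 < 1"
      using a b power_strict_mono[of "norm (Ln a)" 1 2] power_strict_mono[of "norm (Ln b)" 1 2]
      by (auto simp: N w_def)
    thus ?thesis using t by (intro convex_bound_lt) auto
  qed
  finally have "(norm (Ln (w t)))\<^sup>2 < 1\<^sup>2" by (simp add: N)
  thus ?thesis unfolding w_def by (rule power2_less_imp_less) simp
qed

lemma Re_exp_pos:
  assumes "norm (z::complex) < 1"
  shows "0 < Re (exp z)"
proof -
  have "\<bar>Im z\<bar> < pi / 2"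
    using abs_Im_le_cmod[of z] assms pi_gt3 by linarith
  hence "0 < cos (Im z)" by (intro cos_gt_zero_pi) auto
  thus ?thesis by (simp add: Re_exp)
qed

lemma Ln_exp_small:
  assumes "norm (z::complex) < 1"
  shows "Ln (exp z) = z"
  using abs_Im_le_cmod[of z] assms pi_gt3 by (intro Ln_exp) linarith+

text \<open>
  This says that the image of the unit disc under the exponential function is convex. The previous lemma
  improves a bound \<open>\<le> 1\<close> along a segment to \<open>< 1\<close>, so a continuity argument applies: shrink the end
  points to \<open>s a\<close> and \<open>s b\<close>, starting at \<open>s = 0\<close>, where the segment is a point. At the first \<open>s\<close> for
  which the norm reaches \<open>1\<close> somewhere, it is at most \<open>1\<close> everywhere, and the improvement is a
  contradiction.
\<close>
lemma norm_Ln_exp_segment_less_1: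
  fixes a b :: complex
  assumes a: "norm a < 1" and b: "norm b < 1" and t: "0 \<le> t" "t \<le> 1"
  shows "norm (Ln (of_real (1 - t) * exp a + of_real t * exp b)) < 1"
proof -
  define w where "w s t = of_real (1 - t) * exp (of_real s * a) + of_real t * exp (of_real s * b)"
    for s t :: real
  have small: "norm (of_real s * a) < 1" "norm (of_real s * b) < 1" if "s \<in> {0..1}" for s :: real
    using mult_left_le_one_le[of "norm a" s] mult_left_le_one_le[of "norm b" s] that a b
    by (auto simp: norm_mult)
  have w_pos: "0 < Re (w s t)" if "s \<in> {0..1}" "t \<in> {0..1}" for s t
    unfolding w_def using Re_segment_pos[OF Re_exp_pos Re_exp_pos] small[OF that(1)] that(2) by auto
  hence w_Ln: "w s t \<notin> \<real>\<^sub>\<le>\<^sub>0" if "s \<in> {0..1}" "t \<in> {0..1}" for s t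
    using that by (force simp: complex_nonpos_Reals_iff)
  define Q where "Q = (\<lambda>p. norm (Ln (w (fst p) (snd p))))"
  define I :: "(real \<times> real) set" where "I = {0..1} \<times> {0..1}"
  have contQ: "continuous_on I Q"
    unfolding Q_def using w_Ln
    by (intro continuous_on_norm continuous_on_Ln) (auto simp: I_def w_def intro!: continuous_intros)
  define K where "K = I \<inter> Q -` {1..}"
  have "compact K"
  proof -
    have "compact I" by (auto simp: I_def intro!: compact_Times)
    moreover have "closed K"
      unfolding K_def using contQ \<open>compact I\<close>
      by (intro continuous_closed_preimage) (auto intro: compact_imp_closed)
    ultimately show ?thesis using compact_Int_closed[of I K] by (auto simp: K_def Int_absorb1)
  qed
  have "K = {}"
  proof (rule ccontr)
    assume "K \<noteq> {}"
    moreover have "continuous_on K fst" by (intro continuous_intros)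
    ultimately obtain m where m: "m \<in> K" "\<And>p. p \<in> K \<Longrightarrow> fst m \<le> fst p"
      using continuous_attains_inf[OF \<open>compact K\<close>, of fst] by blast
    define s u where "s = fst m" and "u = snd m"
    have s: "s \<in> {0..1}" and u: "u \<in> {0..1}" and Qm: "1 \<le> norm (Ln (w s u))"
      using m(1) by (auto simp: K_def I_def Q_def s_def u_def)
    have less: "norm (Ln (w r v)) < 1" if "r \<in> {0..<s}" "v \<in> {0..1}" for r v
      using m(2)[of "(r, v)"] that s by (auto simp: K_def I_def Q_def s_def not_less[symmetric])
    have "s \<noteq> 0"
    proof
      assume "s = 0"
      hence "w s u = 1" by (simp add: w_def)
      thus False using Qm by simp
    qed
    hence s0: "0 < s" using s by auto
    have le: "norm (Ln (w s v)) \<le> 1" if v: "v \<in> {0..1}" for v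
    proof (rule continuous_le_on_closure[of "{0..<s}" "\<lambda>r. norm (Ln (w r v))"])
      have cl: "closure {0..<s} = {0..s}" using s0 by (rule closure_atLeastLessThan)
      show "continuous_on (closure {0..<s}) (\<lambda>r. norm (Ln (w r v)))"
        unfolding cl using w_Ln v s
        by (intro continuous_on_norm continuous_on_Ln) (auto simp: w_def intro!: continuous_intros)
      show "s \<in> closure {0..<s}" unfolding cl using s0 by simp
    qed (use less v in \<open>auto intro: less_imp_le\<close>)
    have "norm (Ln (w s u)) < 1"
      unfolding w_def
    proof (rule norm_Ln_segment_less_1)
      show "norm (Ln (of_real (1 - t) * exp (of_real s * a) + of_real t * exp (of_real s * b))) \<le> 1"
        if "0 \<le> t" "t \<le> 1" for t
        using le[of t] that by (simp add: w_def)
    qed (use s u small[OF s] in \<open>auto simp: Ln_exp_small Re_exp_pos\<close>)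
    thus False using Qm by simp
  qed
  hence "(1, t) \<notin> K" by simp
  hence "\<not> 1 \<le> Q (1, t)" using t by (simp add: K_def I_def)
  thus ?thesis by (simp add: Q_def w_def)
qed

text \<open>
  The primitive of \<open>exp z * (1 + sin z)\<close> that vanishes at \<open>0\<close>: the member of the class whose Schwarz
  function is the identity.
\<close>
definition extremal :: "complex \<Rightarrow> complex" where
  "extremal z = exp z * (1 + (sin z - cos z) / 2) - 1 / 2"

lemma has_field_derivative_extremal:
  "(extremal has_field_derivative exp z * (1 + sin z)) (at z within A)"
  unfolding extremal_def
  by (auto intro!: derivative_eq_intros simp: field_simps)

text \<open>
  The real part of the derivative changes sign in the disc, so it does not give injectivity by itself.
  In the coordinate \<open>w = exp z\<close>, however, the derivative becomes \<open>1 + sin z\<close>, whose real part is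
  positive, and \<open>w\<close> ranges over a convex set. Moving along the segment between \<open>exp a\<close> and \<open>exp b\<close>
  therefore increases the real part of \<open>extremal / (exp b - exp a)\<close> strictly.
\<close>
lemma inj_on_extremal: "inj_on extremal (ball 0 1)"
proof (rule inj_onI, rule ccontr)
  fix a b :: complex
  assume "a \<in> ball 0 1" "b \<in> ball 0 1" and eq: "extremal a = extremal b" and ab: "a \<noteq> b"
  hence a: "norm a < 1" and b: "norm b < 1" by auto
  define d where "d = exp b - exp a"
  have d: "d \<noteq> 0"
    using Ln_exp_small[OF a] Ln_exp_small[OF b] ab by (auto simp: d_def)
  define w where "w t = of_real (1 - t) * exp a + of_real t * exp b" for t
  define G where "G t = Re (extremal (Ln (w t)) / d)" for t
  have "G 0 < G 1"
  proof (rule DERIV_pos_imp_increasing[of 0 1 G])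
    fix t :: real assume t: "0 \<le> t" "t \<le> 1"
    have wpos: "0 < Re (w t)"
      unfolding w_def using Re_segment_pos[OF Re_exp_pos[OF a] Re_exp_pos[OF b] t] .
    have dw: "(w has_vector_derivative d) (at t)"
      unfolding w_def d_def by (auto intro!: derivative_eq_intros simp: algebra_simps)
    have "(Ln has_field_derivative inverse (w t)) (at (w t))"
      using wpos by (intro has_field_derivative_Ln) (auto simp: complex_nonpos_Reals_iff)
    from DERIV_chain[OF has_field_derivative_extremal this]
    have "((extremal \<circ> Ln) has_field_derivative
        exp (Ln (w t)) * (1 + sin (Ln (w t))) * inverse (w t)) (at (w t))" .
    also have "exp (Ln (w t)) * (1 + sin (Ln (w t))) * inverse (w t) = 1 + sin (Ln (w t))"
    proof -
      have "w t \<noteq> 0" using wpos by auto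
      thus ?thesis by simp
    qed
    finally have "((\<lambda>t. extremal (Ln (w t))) has_vector_derivative d * (1 + sin (Ln (w t)))) (at t)"
      using field_vector_diff_chain_at[OF dw] by (simp add: o_def)
    hence "((\<lambda>t. extremal (Ln (w t)) / d) has_vector_derivative 1 + sin (Ln (w t))) (at t)"
      using d by (auto intro!: derivative_eq_intros)
    hence "(G has_real_derivative Re (1 + sin (Ln (w t)))) (at t)"
      unfolding has_real_derivative_iff_has_vector_derivative G_def
      by (rule bounded_linear.has_vector_derivative[OF bounded_linear_Re])
    moreover have "0 < Re (1 + sin (Ln (w t)))"
      unfolding w_def by (intro Re_one_plus_sin_pos norm_Ln_exp_segment_less_1 a b t)
    ultimately show "\<exists>y. (G has_real_derivative y) (at t) \<and> 0 < y" by blast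
  qed simp
  moreover have "G 0 = G 1"
    by (simp add: G_def w_def Ln_exp_small a b eq)
  ultimately show False by simp
qed

lemma extremal_in_class_P_star: "extremal \<in> class_P_star"
proof -
  have deriv: "deriv extremal z = exp z * (1 + sin z)" for z
    by (rule DERIV_imp_deriv[OF has_field_derivative_extremal])
  have hol: "extremal holomorphic_on ball 0 1"
    unfolding holomorphic_on_def field_differentiable_def
    using has_field_derivative_extremal by blast
  have "schwarz_function (\<lambda>z. z)"
    by (auto simp: schwarz_function_def)
  hence "deriv extremal \<prec>\<^sub>s (\<lambda>z. exp z * (1 + sin z))"
    unfolding subordinate_def using hol
    by (auto simp: deriv intro!: holomorphic_intros holomorphic_deriv exI[of _ "\<lambda>z. z"])
  thus ?thesis
    using hol inj_on_extremal by (simp add: class_P_star_def class_S_def deriv)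
      (simp add: extremal_def)
qed

section \<open>The sharp bound\<close>

text \<open>
  The function \<open>exp z * (1 + sin z)\<close> is \<open>1 + 2 z + 3/2 z\<^sup>2 + 1/2 z\<^sup>3 + O(z\<^sup>4)\<close>. Composing with \<open>\<omega>\<close> and
  integrating gives the coefficients of \<open>f\<close> up to order four.
\<close>
lemma hankel_log_inverse_eq_schwarz_coeffs:
  assumes f: "f \<in> class_S" and cover: "ball 0 (1/4) \<subseteq> f ` ball 0 1"
    and \<omega>: "schwarz_function \<omega>"
    and df: "\<And>z. norm z < 1 \<Longrightarrow> deriv f z = exp (\<omega> z) * (1 + sin (\<omega> z))"
    and W: "\<omega> has_fps_expansion W"
  shows "hankel_log_inverse f =
           hankel_in_schwarz_coeffs (fps_nth W 1) (fps_nth W 2) (fps_nth W 3)"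
proof -
  define A where "A = fps_expansion f 0"
  have A: "f has_fps_expansion A"
    unfolding A_def by (rule has_fps_expansion_fps_expansion[of "ball 0 1"])
      (use f in \<open>auto simp: class_S_def\<close>)
  define P :: "complex fps" where "P = fps_exp 1 * (1 + fps_sin 1)"
  have W0: "fps_nth W 0 = 0" by (rule schwarz_function_coeffs(1)[OF \<omega> W])
  have "((\<lambda>z. exp z * (1 + sin z)) \<circ> \<omega>) has_fps_expansion (P oo W)"
    unfolding P_def by (intro has_fps_expansion_compose W W0 fps_expansion_intros)
  also have "?this \<longleftrightarrow> deriv f has_fps_expansion (P oo W)"
  proof (rule has_fps_expansion_cong[OF eventually_mono refl])
    show "eventually (\<lambda>z::complex. z \<in> ball 0 1) (nhds 0)"
      by (intro eventually_nhds_in_open) auto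
  qed (simp add: df)
  finally have "deriv f has_fps_expansion (P oo W)" .
  with has_fps_expansion_deriv[OF A] have eq: "fps_deriv A = P oo W"
    by (rule fps_expansion_unique_complex)
  have sin: "fps_nth (fps_sin (1::complex)) 0 = 0" "fps_nth (fps_sin (1::complex)) (Suc 0) = 1"
    "fps_nth (fps_sin (1::complex)) (Suc (Suc 0)) = 0"
    "fps_nth (fps_sin (1::complex)) (Suc (Suc (Suc 0))) = - 1/6"
    by (simp_all add: fps_sin_def fact_numeral)
  have P: "fps_nth P (Suc 0) = 2" "fps_nth P (Suc (Suc 0)) = 3/2"
    "fps_nth P (Suc (Suc (Suc 0))) = 1/2"
    by (simp_all add: P_def fps_mult_nth sin)
  have "fps_nth (fps_deriv A) n = fps_nth (P oo W) n" for n
    by (simp only: eq)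
  note nth = this[of 1] this[of 2] this[of 3]
  have a2: "fps_nth A 2 = fps_nth W 1"
    using nth(1) by (simp add: fps_compose_nth eval_nat_numeral fps_mult_nth W0 P)
  have "3 * fps_nth A 3 = 2 * fps_nth W 2 + 3/2 * (fps_nth W 1)\<^sup>2"
    using nth(2) by (simp add: fps_compose_nth eval_nat_numeral fps_mult_nth W0 P)
  hence a3: "fps_nth A 3 = 2/3 * fps_nth W 2 + 1/2 * (fps_nth W 1)\<^sup>2"
    by (simp add: field_simps)
  have "4 * fps_nth A 4 = 2 * fps_nth W 3 + 3 * fps_nth W 1 * fps_nth W 2 + 1/2 * fps_nth W 1 ^ 3"
    using nth(3) by (simp add: fps_compose_nth eval_nat_numeral fps_mult_nth W0 P algebra_simps)
  hence a4: "fps_nth A 4 =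
      1/2 * fps_nth W 3 + 3/4 * fps_nth W 1 * fps_nth W 2 + 1/8 * fps_nth W 1 ^ 3"
    by (simp add: field_simps)
  show ?thesis
    unfolding hankel_log_inverse_def log_inverse_coeffs_low[OF f cover A] a2 a3 a4
      hankel_in_schwarz_coeffs_def
    by (simp add: power2_eq_square power3_eq_cube power4_eq_xxxx algebra_simps)
qed

theorem theorem3p6:
  shows "(\<forall>f\<in>class_P_star. norm (hankel_log_inverse f) \<le> 11 / 96) \<and>
         (\<exists>f\<in>class_P_star. norm (hankel_log_inverse f) = 11 / 96)"
proof (intro conjI ballI bexI)
  fix f assume f: "f \<in> class_P_star"
  hence S: "f \<in> class_S" by (simp add: class_P_star_def)
  obtain \<omega> where \<omega>: "schwarz_function \<omega>"
    and df: "\<And>z. norm z < 1 \<Longrightarrow> deriv f z = exp (\<omega> z) * (1 + sin (\<omega> z))"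
    using class_P_starE[OF f] by blast
  define W where "W = fps_expansion \<omega> 0"
  have W: "\<omega> has_fps_expansion W"
    unfolding W_def by (rule schwarz_function_has_fps_expansion[OF \<omega>])
  obtain x y where "norm (fps_nth W 1) \<le> 1" "norm x \<le> 1" "norm y \<le> 1 - (norm x)\<^sup>2"
    and eqs: "fps_nth W 2 = (1 - fps_nth W 1 * cnj (fps_nth W 1)) * x"
      "fps_nth W 3 = (1 - fps_nth W 1 * cnj (fps_nth W 1)) * (y - cnj (fps_nth W 1) * x\<^sup>2)"
    by (rule schwarz_function_schur_parameters[OF \<omega> W])
  hence "norm (hankel_in_schwarz_coeffs (fps_nth W 1) (fps_nth W 2) (fps_nth W 3)) \<le> 11 / 96"
    unfolding eqs by (intro norm_hankel_in_schur_parameters_le)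
  moreover have "hankel_log_inverse f =
      hankel_in_schwarz_coeffs (fps_nth W 1) (fps_nth W 2) (fps_nth W 3)"
    by (rule hankel_log_inverse_eq_schwarz_coeffs
          [OF S class_P_star_covers_quarter_disc[OF f] \<omega> df W])
  ultimately show "norm (hankel_log_inverse f) \<le> 11 / 96" by simp
next
  show ext: "extremal \<in> class_P_star" by (rule extremal_in_class_P_star)
  hence S: "extremal \<in> class_S" by (simp add: class_P_star_def)
  have "hankel_log_inverse extremal = hankel_in_schwarz_coeffs 1 0 0"
    using hankel_log_inverse_eq_schwarz_coeffs
      [OF S class_P_star_covers_quarter_disc[OF ext] _ _ has_fps_expansion_fps_X]
    by (simp add: schwarz_function_def DERIV_imp_deriv[OF has_field_derivative_extremal])
  also have "\<dots> = 11 / 96"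
    by (simp add: hankel_in_schwarz_coeffs_def)
  finally show "norm (hankel_log_inverse extremal) = 11 / 96"
    by (simp only: norm_divide norm_numeral)
qed

end
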